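(* Let $a,\alpha_1,\alpha_2,\beta\in(0,1)$ and let $b_1,b_2,b_3\in(0,1)$ satisfy $b_1+b_2+b_3=1$. Then the inequality $$a f(\alpha_1 x+(1-\alpha_1)y)+(1-a)f(\alpha_2 x+(1-\alpha_2)y)\leq b_1 f(x)+b_2 f(\beta x+(1-\beta)y)+b_3 f(y)$$ is satisfied by all convex functions $f:[x,y]\to\mathbb{R}$ if and only if we have $$b_2(1-\beta)+b_3=a(1-\alpha_1)+(1-a)(1-\alpha_2)$$ and one of the following conditions is satisfied: (i) $a\leq b_1$, (ii) $a\geq b_1+b_2$, (iii) $\alpha_2\geq\beta$, or (iv) $a\in(b_1,b_1+b_2)$, $\alpha_2<\beta$ and $(1-\alpha_1)b_1\geq(\alpha_1-\beta)(a-b_1)$.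
   Context: Here $x,y\in\mathbb{R}$ with $x<y$ are the endpoints of the interval $[x,y]$ on which the convex functions $f$ are defined, and $(p,q)$ denotes the open interval of real numbers between $p$ and $q$.
   Formalization: The formal theorem adds α₂ ≤ α₁ (the node with weight a is the left one); without it the "if" direction fails, e.g. a=b₁=2/5, α₁=3/10, α₂=23/24, β=1/2, b₂=59/100, b₃=1/100, and relabelling the two nodes always achieves this order. *)

theory Defs
  imports "HOL-Analysis.Analysis"
begin

end

theory Submission
  imports Defs
begin

text \<open>
  Both sides of the inequality integrate \<open>f\<close> against a probability measure on \<open>[x, y]\<close>, and the
  right-hand measure has atoms at \<open>x\<close>, \<open>y\<close> and a single interior point \<open>m\<close>. Replace \<open>f\<close> by the
  piecewise linear function \<open>g\<close> that agrees with \<open>f\<close> at \<open>x\<close>, \<open>m\<close> and \<open>y\<close>: this does not change the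
  right-hand side, and by convexity it can only increase the left-hand side
  (\<open>convex_on_le_interpolation\<close>). So it is enough to test the functions \<open>g\<close>. Each of
  them is an affine function plus a nonnegative multiple of \<open>t \<mapsto> max 0 (t - m)\<close>, because \<open>f\<close> has
  increasing slopes. Affine functions give equality of the barycentres, and the remaining hinge
  function gives one scalar inequality; this is \<open>convex_ineq_iff_barycentre_and_hinge\<close>.

  What is left is arithmetic. Given equal barycentres, the hinge inequality is automatic when \<open>m\<close>
  does not separate the two left-hand nodes. When it does, the inequality becomes linear, and eliminating \<open>\<alpha>2\<close> by the
  barycentre equation turns it into the last inequality of condition (iv), which conditions (i)
  and (ii) imply (\<open>hinge_condition_iff\<close>).
\<close>

text \<open>The bound is the chord of \<open>f\<close> over \<open>[x, m]\<close> to the left of \<open>m\<close> and the chord over \<open>[m, y]\<close> to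
  the right of it, written as an affine function plus a hinge so that integrating it only involves
  the mass, the barycentre and the integral of the hinge.\<close>

lemma convex_on_le_interpolation:
  fixes f :: "real \<Rightarrow> real"
  assumes f: "convex_on {x..y} f" and m: "x < m" "m < y" and t: "t \<in> {x..y}"
  defines "p \<equiv> (f m - f x) / (m - x)" and "q \<equiv> (f y - f m) / (y - m)"
  shows "f t \<le> f m + p * (t - m) + (q - p) * max 0 (t - m)"
proof (cases "t \<le> m")
  case True
  have "convex_on {x..m} f"
    using f m by (auto intro: convex_on_subset)
  then have "f t \<le> (f x - f m) / (m - x) * (m - t) + f m"
    using True t m by (intro convex_onD_Icc'') auto
  also have "\<dots> = f m + p * (t - m) + (q - p) * max 0 (t - m)"
    using True m by (simp add: p_def field_simps)
  finally show ?thesis .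
next
  case False
  have "convex_on {m..y} f"
    using f m by (auto intro: convex_on_subset)
  then have "f t \<le> (f y - f m) / (y - m) * (t - m) + f m"
    using False t m by (intro convex_onD_Icc') auto
  also have "\<dots> = f m + p * (t - m) + (q - p) * max 0 (t - m)"
    using False by (simp add: q_def algebra_simps)
  finally show ?thesis .
qed

lemma convex_on_slopes_mono:
  fixes f :: "real \<Rightarrow> real"
  assumes f: "convex_on {x..y} f" and m: "x < m" "m < y"
  shows "(f m - f x) / (m - x) \<le> (f y - f m) / (y - m)"
proof -
  have "(f x - f m) / (x - m) \<le> (f m - f y) / (m - y)"
    using convex_on_slope_le[OF f, of x y m] m by auto
  moreover have "(f x - f m) / (x - m) = (f m - f x) / (m - x)"
    "(f m - f y) / (m - y) = (f y - f m) / (y - m)"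
    by (metis minus_diff_eq minus_divide_divide)+
  ultimately show ?thesis
    by simp
qed

lemma convex_on_hinge: "convex_on S (\<lambda>t::real. max 0 (t - m))" if "convex S"
proof (rule convex_onI[OF _ that])
  fix s u v :: real
  assume s: "0 < s" "s < 1"
  have "(1 - s) * (u - m) \<le> (1 - s) * max 0 (u - m)" "s * (v - m) \<le> s * max 0 (v - m)"
    using s by (auto intro!: mult_left_mono)
  moreover have "0 \<le> (1 - s) * max 0 (u - m)" "0 \<le> s * max 0 (v - m)"
    using s by auto
  ultimately show "max 0 ((1 - s) *\<^sub>R u + s *\<^sub>R v - m)
      \<le> (1 - s) * max 0 (u - m) + s * max 0 (v - m)"
    by (intro max.boundedI) (simp_all add: algebra_simps)
qed

text \<open>A right-hand measure with one interior atom leaves a single extreme ray of convex functions,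
  modulo affine ones, to be tested.\<close>

lemma convex_ineq_iff_barycentre_and_hinge:
  fixes x y m u v a b1 b2 b3 :: real
  assumes m: "x < m" "m < y" and u: "u \<in> {x..y}" and v: "v \<in> {x..y}"
    and a: "0 \<le> a" "a \<le> 1" and b: "b1 + b2 + b3 = 1"
  shows "(\<forall>f :: real \<Rightarrow> real. convex_on {x..y} f \<longrightarrow>
            a * f u + (1 - a) * f v \<le> b1 * f x + b2 * f m + b3 * f y)
         \<longleftrightarrow>
         (b1 * x + b2 * m + b3 * y = a * u + (1 - a) * v \<and>
          a * max 0 (u - m) + (1 - a) * max 0 (v - m) \<le> b3 * (y - m))"
    (is "?L \<longleftrightarrow> ?bary \<and> ?hinge")
proof
  assume L: ?L
  have "convex_on {x..y} (\<lambda>t. t)" "convex_on {x..y} (\<lambda>t. - t)"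
    by (auto intro!: convex_onI simp: algebra_simps)
  then have "a * u + (1 - a) * v \<le> b1 * x + b2 * m + b3 * y"
    and "a * - u + (1 - a) * - v \<le> b1 * - x + b2 * - m + b3 * - y"
    using L by blast+
  then have ?bary
    by simp
  moreover have ?hinge
    using L[rule_format, OF convex_on_hinge[of _ m]] m by simp
  ultimately show "?bary \<and> ?hinge" ..
next
  assume R: "?bary \<and> ?hinge"
  show ?L
  proof (intro allI impI)
    fix f :: "real \<Rightarrow> real"
    assume f: "convex_on {x..y} f"
    define p where "p = (f m - f x) / (m - x)"
    define q where "q = (f y - f m) / (y - m)"
    define H where "H = a * max 0 (u - m) + (1 - a) * max 0 (v - m)"
    have pq: "p \<le> q"
      using convex_on_slopes_mono[OF f m] by (simp add: p_def q_def)
    have fx: "f x = f m + p * (x - m)" and fy: "f y = f m + p * (y - m) + (q - p) * (y - m)"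
    proof -
      have "p * (m - x) = f m - f x" "q * (y - m) = f y - f m"
        using m by (simp_all add: p_def q_def)
      then show "f x = f m + p * (x - m)" "f y = f m + p * (y - m) + (q - p) * (y - m)"
        by algebra+
    qed
    have "a * f u + (1 - a) * f v
        \<le> a * (f m + p * (u - m) + (q - p) * max 0 (u - m))
          + (1 - a) * (f m + p * (v - m) + (q - p) * max 0 (v - m))"
      using convex_on_le_interpolation[OF f m u] convex_on_le_interpolation[OF f m v] a
      unfolding p_def q_def by (intro add_mono mult_left_mono) auto
    also have "\<dots> = f m + p * ((a * u + (1 - a) * v) - m) + (q - p) * H"
      unfolding H_def by algebra
    also have "\<dots> \<le> f m + p * ((a * u + (1 - a) * v) - m) + (q - p) * (b3 * (y - m))"
      using R pq by (intro add_left_mono mult_left_mono) (auto simp: H_def)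
    also have "\<dots> = f m + p * ((b1 * x + b2 * m + b3 * y) - m) + (q - p) * (b3 * (y - m))"
      using R by simp
    also have "\<dots> = b1 * f x + b2 * f m + b3 * f y"
      using b unfolding fx fy by algebra
    finally show "a * f u + (1 - a) * f v \<le> b1 * f x + b2 * f m + b3 * f y" .
  qed
qed

text \<open>The coordinates here are the weights of the endpoint \<open>x\<close>, so they decrease along \<open>[x, y]\<close> and
  the node with weight \<open>a\<close> is the one nearer to \<open>x\<close>. The position of \<open>\<beta>\<close> relative to \<open>\<alpha>2 \<le> \<alpha>1\<close>
  decides which of the two hinge terms survive.\<close>

lemma hinge_condition_iff:
  fixes a \<alpha>1 \<alpha>2 \<beta> b1 b2 b3 :: real
  assumes a: "0 < a" "a < 1" and \<alpha>: "\<alpha>2 \<le> \<alpha>1" "\<alpha>1 < 1" "0 < \<alpha>2" and \<beta>: "0 < \<beta>" "\<beta> < 1"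
    and b: "0 < b1" "0 < b3" "b1 + b2 + b3 = 1"
    and bary: "b1 + b2 * \<beta> = a * \<alpha>1 + (1 - a) * \<alpha>2"
  shows "a * max 0 (\<beta> - \<alpha>1) + (1 - a) * max 0 (\<beta> - \<alpha>2) \<le> b3 * \<beta> \<longleftrightarrow>
         (a \<le> b1 \<or> a \<ge> b1 + b2 \<or> \<alpha>2 \<ge> \<beta> \<or>
          (a \<in> {b1<..<b1 + b2} \<and> \<alpha>2 < \<beta> \<and> (1 - \<alpha>1) * b1 \<ge> (\<alpha>1 - \<beta>) * (a - b1)))"
    (is "?H \<longleftrightarrow> ?C")
proof -
  consider "\<beta> \<le> \<alpha>2" | "\<alpha>2 < \<beta>" "\<alpha>1 \<le> \<beta>" | "\<alpha>2 < \<beta>" "\<beta> < \<alpha>1"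
    by linarith
  then show ?thesis
  proof cases
    case 1
    then show ?thesis
      using \<alpha> \<beta> b by simp
  next
    case 2
    \<comment> \<open>Both nodes lie beyond \<open>m\<close>, so the left-hand side is \<open>\<beta>\<close> minus the barycentre.\<close>
    have "a * (\<beta> - \<alpha>1) + (1 - a) * (\<beta> - \<alpha>2) = b3 * \<beta> - b1 * (1 - \<beta>)"
      using bary b(3) by algebra
    moreover have "0 \<le> b1 * (1 - \<beta>)"
      using b \<beta> by simp
    ultimately have ?H
      using 2 by simp
    moreover have "(\<alpha>1 - \<beta>) * (a - b1) \<le> (1 - \<alpha>1) * b1" if "b1 < a"
    proof -
      have "(\<alpha>1 - \<beta>) * (a - b1) \<le> 0"
        using 2 that by (intro mult_nonpos_nonneg) auto
      also have "0 \<le> (1 - \<alpha>1) * b1"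
        using \<alpha> b by simp
      finally show ?thesis .
    qed
    ultimately show ?thesis
      using 2 by auto
  next
    case 3
    \<comment> \<open>Only the node with weight \<open>1 - a\<close> lies beyond \<open>m\<close>; the barycentre equation trades it for
      the other one.\<close>
    have "b3 * \<beta> - (1 - a) * (\<beta> - \<alpha>2) = (1 - \<alpha>1) * b1 - (\<alpha>1 - \<beta>) * (a - b1)"
      using bary b(3) by algebra
    then have H: "?H \<longleftrightarrow> (\<alpha>1 - \<beta>) * (a - b1) \<le> (1 - \<alpha>1) * b1"
      using 3 by (simp add: max_def) linarith
    have "(\<alpha>1 - \<beta>) * (a - b1) \<le> (1 - \<alpha>1) * b1" if "a \<le> b1"
    proof -
      have "(\<alpha>1 - \<beta>) * (a - b1) \<le> 0"
        using 3 that by (intro mult_nonneg_nonpos) auto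
      also have "0 \<le> (1 - \<alpha>1) * b1"
        using \<alpha> b by simp
      finally show ?thesis .
    qed
    moreover have ?H if "b1 + b2 \<le> a"
    proof -
      have "(1 - a) * (\<beta> - \<alpha>2) \<le> b3 * \<beta>"
        using 3 that \<alpha> b by (intro mult_mono) auto
      then show ?thesis
        using 3 by simp
    qed
    ultimately show ?thesis
      using 3 H by auto
  qed
qed

theorem theorem4:
  fixes x y a \<alpha>1 \<alpha>2 \<beta> b1 b2 b3 :: real
  assumes xy: "x < y"
    and a: "a \<in> {0<..<1}"
    and \<alpha>1: "\<alpha>1 \<in> {0<..<1}"
    and \<alpha>2: "\<alpha>2 \<in> {0<..<1}"
    and \<beta>: "\<beta> \<in> {0<..<1}"
    and b1: "b1 \<in> {0<..<1}"
    and b2: "b2 \<in> {0<..<1}"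
    and b3: "b3 \<in> {0<..<1}"
    and b_sum: "b1 + b2 + b3 = 1"
    \<comment> \<open>The node with weight \<open>a\<close> is the left one. The left-hand side below is symmetric under
      swapping \<open>(a, \<alpha>1)\<close> with \<open>(1 - a, \<alpha>2)\<close>, but conditions (i)-(iv) are not; without this
      convention the equivalence fails.\<close>
    and order: "\<alpha>2 \<le> \<alpha>1"
  shows "(\<forall>f :: real \<Rightarrow> real. convex_on {x..y} f \<longrightarrow>
            a * f (\<alpha>1 * x + (1 - \<alpha>1) * y) + (1 - a) * f (\<alpha>2 * x + (1 - \<alpha>2) * y)
              \<le> b1 * f x + b2 * f (\<beta> * x + (1 - \<beta>) * y) + b3 * f y)
         \<longleftrightarrow>
         (b2 * (1 - \<beta>) + b3 = a * (1 - \<alpha>1) + (1 - a) * (1 - \<alpha>2) \<and>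
          (a \<le> b1 \<or>
           a \<ge> b1 + b2 \<or>
           \<alpha>2 \<ge> \<beta> \<or>
           (a \<in> {b1<..<b1 + b2} \<and> \<alpha>2 < \<beta> \<and> (1 - \<alpha>1) * b1 \<ge> (\<alpha>1 - \<beta>) * (a - b1))))"
proof -
  define d where "d = y - x"
  define m where "m = \<beta> * x + (1 - \<beta>) * y"
  define u where "u = \<alpha>1 * x + (1 - \<alpha>1) * y"
  define v where "v = \<alpha>2 * x + (1 - \<alpha>2) * y"
  have d: "0 < d"
    using xy by (simp add: d_def)
  have nodes: "m = x + (1 - \<beta>) * d" "u = x + (1 - \<alpha>1) * d" "v = x + (1 - \<alpha>2) * d" "y = x + d"
    by (simp_all add: m_def u_def v_def d_def algebra_simps)
  have frac: "0 < s * d" "s * d < d" if "s \<in> {0<..<1}" for s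
    using that d by simp_all
  have m: "x < m" "m < y" and uv: "u \<in> {x..y}" "v \<in> {x..y}"
    using frac[of "1 - \<beta>"] frac[of "1 - \<alpha>1"] frac[of "1 - \<alpha>2"] \<alpha>1 \<alpha>2 \<beta> unfolding nodes by auto
  have "b1 * x + b2 * m + b3 * y - (a * u + (1 - a) * v)
      = (b2 * (1 - \<beta>) + b3 - (a * (1 - \<alpha>1) + (1 - a) * (1 - \<alpha>2))) * d"
    using b_sum unfolding nodes by algebra
  then have bary: "b1 * x + b2 * m + b3 * y = a * u + (1 - a) * v \<longleftrightarrow>
      b2 * (1 - \<beta>) + b3 = a * (1 - \<alpha>1) + (1 - a) * (1 - \<alpha>2)"
    using d by (metis eq_iff_diff_eq_0 less_irrefl mult_eq_0_iff)
  have pos: "max 0 (s * d) = max 0 s * d" for s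
    using d by (simp add: max_def zero_le_mult_iff mult_le_0_iff)
  have diffs: "u - m = (\<beta> - \<alpha>1) * d" "v - m = (\<beta> - \<alpha>2) * d" "y - m = \<beta> * d"
    by (simp_all add: nodes algebra_simps)
  have "a * max 0 (u - m) + (1 - a) * max 0 (v - m)
      = (a * max 0 (\<beta> - \<alpha>1) + (1 - a) * max 0 (\<beta> - \<alpha>2)) * d"
    unfolding diffs pos by (simp add: algebra_simps)
  moreover have "b3 * (y - m) = (b3 * \<beta>) * d"
    unfolding diffs by simp
  ultimately have hinge: "a * max 0 (u - m) + (1 - a) * max 0 (v - m) \<le> b3 * (y - m) \<longleftrightarrow>
      a * max 0 (\<beta> - \<alpha>1) + (1 - a) * max 0 (\<beta> - \<alpha>2) \<le> b3 * \<beta>"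
    using d by (simp only: mult_le_cancel_right_pos)
  have "b1 + b2 * \<beta> = a * \<alpha>1 + (1 - a) * \<alpha>2"
    if "b2 * (1 - \<beta>) + b3 = a * (1 - \<alpha>1) + (1 - a) * (1 - \<alpha>2)"
    using that b_sum by algebra
  note cond = hinge_condition_iff[OF _ _ order _ _ _ _ _ _ b_sum this]
  show ?thesis
    unfolding m_def[symmetric] u_def[symmetric] v_def[symmetric]
    using convex_ineq_iff_barycentre_and_hinge[OF m uv _ _ b_sum, of a] a
    unfolding bary hinge
    using cond \<alpha>1 \<alpha>2 \<beta> b1 b3 by auto
qed

end
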